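(* For all integers $k\ge 1$, $n\ge 0$ and all $$(a,b,c)\in\{(1,2,3),(1,2,5),(1,2,7),(1,3,4),(1,3,5),(1,3,8),(1,4,5),(1,4,7)\},$$ we have $\gamma_{a,b,c,3/2,1/2}^k(n)\ge 0$; that is, the coefficient of $q^n$ in $$\frac{1}{(1-q^a)(1-q^b)(1-q^c)}\sum_{j\notin[-k,k-1]}(-1)^{j+k}q^{j(3j+1)/2}$$ is nonnegative.
   Context: Identities are between formal power series in $q$. The sum $\sum_{j\notin[-k,k-1]}$ is over all integers $j\le -k-1$ and all integers $j\ge k$. In general $\gamma_{a,b,c,A,B}^k(n)$ is defined by $\frac{1}{(1-q^a)(1-q^b)(1-q^c)}\sum_{j\notin[-k,k-1]}(-1)^{j+k}q^{Aj^2+Bj}=\sum_{n\ge0}\gamma_{a,b,c,A,B}^k(n)q^n$. *)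

theory Defs
  imports
    "HOL-Analysis.Infinite_Sum"
    "HOL-Computational_Algebra.Formal_Power_Series"
begin

text \<open>
  The two-sided infinite sum is an unordered sum in the standard (q-adic) topology on formal
  power series; the coefficients are taken in \<^typ>\<open>rat\<close> so that the division below is
  available.  The parameters \<open>A\<close> and \<open>B\<close> are rational because half-integral values occur.
  The exponent \<open>A j\<^sup>2 + B j\<close> has to be a natural number for all \<open>j\<close> in the range of summation;
  for \<open>A = 3/2\<close>, \<open>B = 1/2\<close> this is \<open>theta_exponent_pentagonal\<close> below.
\<close>

definition theta_exponent :: "rat \<Rightarrow> rat \<Rightarrow> int \<Rightarrow> nat" where
  "theta_exponent A B j = nat \<lfloor>A * of_int j ^ 2 + B * of_int j\<rfloor>"

definition truncated_theta :: "rat \<Rightarrow> rat \<Rightarrow> int \<Rightarrow> rat fps" where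
  "truncated_theta A B k =
     (\<Sum>\<^sub>\<infinity>j\<in>{j. j \<notin> {-k..k-1}}.
        fps_const ((-1) powi (j + k)) * fps_X ^ theta_exponent A B j)"

definition gamma :: "nat \<Rightarrow> nat \<Rightarrow> nat \<Rightarrow> rat \<Rightarrow> rat \<Rightarrow> int \<Rightarrow> nat \<Rightarrow> rat" where
  "gamma a b c A B k n =
     fps_nth (1 / ((1 - fps_X ^ a) * (1 - fps_X ^ b) * (1 - fps_X ^ c)) * truncated_theta A B k) n"

lemma theta_exponent_pentagonal:
  "of_nat (theta_exponent (3/2) (1/2) j) = (3/2 * of_int j ^ 2 + 1/2 * of_int j :: rat)"
  "int (theta_exponent (3/2) (1/2) j) = j * (3 * j + 1) div 2"
proof -
  have "even (j * (3 * j + 1))"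
    by auto
  then obtain m where m: "j * (3 * j + 1) = 2 * m" by (elim evenE)
  have "0 \<le> j * (3 * j + 1)"
    by (cases "j \<ge> 0") (auto simp: zero_le_mult_iff)
  with m have "m \<ge> 0" by linarith
  have "(of_int (j * (3 * j + 1)) :: rat) = of_int (2 * m)"
    using m by presburger
  then have eq: "3/2 * of_int j ^ 2 + 1/2 * of_int j = (of_int m :: rat)"
    by (simp add: algebra_simps power2_eq_square)
  have "int (theta_exponent (3/2) (1/2) j) = m"
    unfolding theta_exponent_def eq using \<open>m \<ge> 0\<close> by simp
  then show "of_nat (theta_exponent (3/2) (1/2) j) = (3/2 * of_int j ^ 2 + 1/2 * of_int j :: rat)"
    and "int (theta_exponent (3/2) (1/2) j) = j * (3 * j + 1) div 2"
    unfolding eq using m by (metis of_int_of_nat_eq, simp)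
qed

lemma has_sum_fps_monomials:
  fixes c :: "'i \<Rightarrow> 'a::comm_ring_1" and e :: "'i \<Rightarrow> nat"
  assumes fin: "\<And>n. finite {j\<in>S. e j = n}"
  shows "((\<lambda>j. fps_const (c j) * fps_X ^ e j) has_sum
           Abs_fps (\<lambda>n. \<Sum>j\<in>{j\<in>S. e j = n}. c j)) S"
  unfolding has_sum_def
proof (rule tendsto_fpsI)
  fix n
  have "fps_nth (\<Sum>j\<in>F. fps_const (c j) * fps_X ^ e j) n = (\<Sum>j\<in>{j\<in>S. e j = n}. c j)"
    if F: "finite F" "{j\<in>S. e j = n} \<subseteq> F" "F \<subseteq> S" for F
  proof -
    have "fps_nth (\<Sum>j\<in>F. fps_const (c j) * fps_X ^ e j) n = (\<Sum>j\<in>F. if e j = n then c j else 0)"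
      by (auto simp: fps_sum_nth fps_X_power_nth intro!: sum.cong)
    also have "\<dots> = (\<Sum>j\<in>F \<inter> {j. e j = n}. c j)"
      using F(1) by (simp add: sum.If_cases)
    also have "F \<inter> {j. e j = n} = {j\<in>S. e j = n}"
      using F by auto
    finally show ?thesis .
  qed
  then show "\<forall>\<^sub>F F in finite_subsets_at_top S.
      fps_nth (\<Sum>j\<in>F. fps_const (c j) * fps_X ^ e j) n
        = fps_nth (Abs_fps (\<lambda>n. \<Sum>j\<in>{j\<in>S. e j = n}. c j)) n"
    unfolding eventually_finite_subsets_at_top
    using fin[of n] by (intro exI[of _ "{j\<in>S. e j = n}"]) auto
qed

lemma finite_theta_exponent_pentagonal:
  "finite {j\<in>S. theta_exponent (3/2) (1/2) j = n}"
proof (rule finite_subset)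
  show "{j\<in>S. theta_exponent (3/2) (1/2) j = n} \<subseteq> {- int n .. int n}"
  proof safe
    fix j :: int
    have "\<bar>j\<bar> \<le> j * (3 * j + 1) div 2"
    proof -
      have "2 * \<bar>j\<bar> \<le> j * (3 * j + 1)"
      proof (cases "j = 0")
        case False
        then have "\<bar>j\<bar> * 1 \<le> \<bar>j\<bar> * \<bar>j\<bar>" by (intro mult_left_mono) auto
        then have "\<bar>j\<bar> \<le> j * j" by simp
        then show ?thesis by (simp add: algebra_simps)
      qed simp
      then show ?thesis by linarith
    qed
    then show "j \<in> {- int (theta_exponent (3/2) (1/2) j) .. int (theta_exponent (3/2) (1/2) j)}"
      unfolding theta_exponent_pentagonal(2) atLeastAtMost_iff by linarith
  qed
qed simp

text \<open>The infinite sum converges, so \<^const>\<open>infsum\<close> does not take its default value.\<close>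

lemma truncated_theta_pentagonal_has_sum:
  "((\<lambda>j. fps_const ((-1) powi (j + k)) * fps_X ^ theta_exponent (3/2) (1/2) j)
      has_sum truncated_theta (3/2) (1/2) k) {j. j \<notin> {-k..k-1}}"
  unfolding truncated_theta_def
  by (rule has_sum_infsum, rule has_sum_imp_summable,
      rule has_sum_fps_monomials, rule finite_theta_exponent_pentagonal)

lemma truncated_theta_pentagonal_nth:
  "fps_nth (truncated_theta (3/2) (1/2) k) n =
     (\<Sum>j\<in>{j\<in>{j. j \<notin> {-k..k-1}}. theta_exponent (3/2) (1/2) j = n}. (-1) powi (j + k))"
  unfolding truncated_theta_def
  by (subst infsumI[OF has_sum_fps_monomials[OF finite_theta_exponent_pentagonal]]) simp

end

theory Submission
  imports Defs
begin

text \<open>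
  Pairing \<open>j\<close> with \<open>- j - 1\<close> turns the coefficient into the alternating sum over \<open>j \<ge> k\<close> of
  \<open>p (n - e j) - p (n - e j - (2 j + 1))\<close>, where \<open>e j = j (3 j + 1) / 2\<close> and \<open>p\<close> counts partitions
  into parts \<open>1, b, c\<close>.  For coprime \<open>b, c\<close> and \<open>s = 1 + b + c\<close>, the number \<open>8 b c p m\<close> is
  \<open>(2 m + s)\<^sup>2\<close> plus a \<open>b\<close>-periodic and a \<open>c\<close>-periodic function of \<open>m > - s\<close>.  Let \<open>K\<close>
  be the last index with \<open>e K \<le> n\<close>.  The squares contribute a telescoping sum, which is at least
  \<open>4 (K\<^sup>2 + K - 2)\<close> if \<open>K > k\<close> and \<open>K \<ge> 8\<close>.  The periodic parts contribute a bounded amount, because the alternating sum of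
  \<open>u (n - e j) - u (n - e j - (2 j + 1))\<close> over \<open>2 d\<close> consecutive \<open>j\<close> vanishes for the
  \<open>d\<close>-periodic functions \<open>u\<close> at hand.  Hence the claim holds for large \<open>K\<close>.  For \<open>K = k\<close> it is the
  monotonicity of \<open>p\<close>, and the remaining \<open>n\<close> are finitely many.
\<close>

section \<open>Generalized pentagonal numbers\<close>

definition pent :: "int \<Rightarrow> int" where
  "pent j = j * (3 * j + 1) div 2"

lemma two_pent: "2 * pent j = 3 * j\<^sup>2 + j"
proof -
  have "even (j * (3 * j + 1))" by auto
  then show ?thesis unfolding pent_def by (simp add: algebra_simps power2_eq_square)
qed

lemma pent_add1: "pent (j + 1) = pent j + 3 * j + 2"
proof -
  have "2 * pent (j + 1) = 2 * (pent j + 3 * j + 2)"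
    unfolding two_pent distrib_left by (simp add: power2_eq_square algebra_simps two_pent)
  then show ?thesis by simp
qed

lemma pent_reflect: "pent (- j - 1) = pent j + (2 * j + 1)"
proof -
  have "2 * pent (- j - 1) = 2 * (pent j + (2 * j + 1))"
    unfolding two_pent distrib_left by (simp add: power2_eq_square algebra_simps two_pent)
  then show ?thesis by simp
qed

text \<open>The shift is by \<open>2 * d\<close> because for even \<open>d\<close> a shift by
  \<open>d\<close> changes \<open>pent\<close> by an odd multiple of \<open>d / 2\<close>. With the
  double shift, \<open>pent\<close> is periodic modulo every \<open>d\<close>.\<close>

lemma pent_add_period: "pent (j + 2 * d) = pent j + d * (6 * j + 6 * d + 1)"
proof -
  have "2 * pent (j + 2 * d) = 2 * (pent j + d * (6 * j + 6 * d + 1))"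
    unfolding two_pent distrib_left by (simp add: power2_eq_square algebra_simps two_pent)
  then show ?thesis by simp
qed

lemma pent_mono:
  assumes "0 \<le> i" "i \<le> j"
  shows "pent i \<le> pent j"
proof -
  have "i\<^sup>2 \<le> j\<^sup>2" using assms by (intro power_mono) auto
  then show ?thesis using two_pent[of i] two_pent[of j] assms by linarith
qed

lemma pent_ge: "\<bar>j\<bar> \<le> pent j"
proof -
  have "\<bar>j\<bar> \<le> j\<^sup>2"
  proof (cases "j = 0")
    case False
    then have "\<bar>j\<bar> * 1 \<le> \<bar>j\<bar> * \<bar>j\<bar>" by (intro mult_left_mono) auto
    then show ?thesis by (simp add: power2_eq_square)
  qed simp
  then show ?thesis using two_pent[of j] by linarith
qed

lemma theta_exponent_eq_pent: "int (theta_exponent (3/2) (1/2) j) = pent j"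
  by (simp add: theta_exponent_pentagonal(2) pent_def)

section \<open>Finite alternating sums\<close>

text \<open>The first term has sign plus whatever the parity of \<open>k\<close>, matching the
  factor \<open>(-1) powi (j + k)\<close>.\<close>

primrec alt_sum :: "(int \<Rightarrow> 'a::ab_group_add) \<Rightarrow> int \<Rightarrow> nat \<Rightarrow> 'a" where
  "alt_sum g k 0 = 0"
| "alt_sum g k (Suc l) = g k - alt_sum g (k + 1) l"

lemma alt_sum_cong:
  assumes "\<And>j. \<lbrakk>k \<le> j; j < k + int l\<rbrakk> \<Longrightarrow> g j = h j"
  shows "alt_sum g k l = alt_sum h k l"
  using assms
proof (induction l arbitrary: k)
  case (Suc l)
  have "alt_sum g (k + 1) l = alt_sum h (k + 1) l"
    by (rule Suc.IH) (use Suc.prems in auto)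
  then show ?case using Suc.prems[of k] by simp
qed simp

lemma alt_sum_add: "alt_sum (\<lambda>j. g j + h j) k l = alt_sum g k l + alt_sum h k l"
  by (induction l arbitrary: k) auto

lemma alt_sum_cmult: "alt_sum (\<lambda>j. c * g j) k l = (c :: 'a :: ring) * alt_sum g k l"
  by (induction l arbitrary: k) (auto simp: algebra_simps)

lemma alt_sum_append:
  "alt_sum g k (l + m) = alt_sum g k l + (-1 :: 'a :: comm_ring_1) ^ l * alt_sum g (k + int l) m"
  by (induction l arbitrary: k) (auto simp: algebra_simps)

lemma alt_sum_eq_0:
  assumes "\<And>j. \<lbrakk>k \<le> j; j < k + int l\<rbrakk> \<Longrightarrow> g j = 0"
  shows "alt_sum g k l = 0"
  using assms
proof (induction l arbitrary: k)
  case (Suc l)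
  have "alt_sum g (k + 1) l = 0"
    by (rule Suc.IH) (use Suc.prems in auto)
  then show ?case using Suc.prems[of k] by simp
qed simp

lemma alt_sum_truncate:
  fixes g :: "int \<Rightarrow> 'a :: comm_ring_1"
  assumes "\<And>j. k + int m \<le> j \<Longrightarrow> g j = 0" "m \<le> l"
  shows "alt_sum g k l = alt_sum g k m"
proof -
  have "alt_sum g k (m + (l - m)) = alt_sum g k m + (-1) ^ m * alt_sum g (k + int m) (l - m)"
    by (rule alt_sum_append)
  also have "alt_sum g (k + int m) (l - m) = 0"
    by (rule alt_sum_eq_0) (use assms in auto)
  finally show ?thesis using assms(2) by simp
qed

lemma alt_sum_telescope:
  fixes A :: "int \<Rightarrow> 'a :: comm_ring_1"
  shows "alt_sum (\<lambda>j. A j + A (j + 1)) k l = A k - (-1) ^ l * A (k + int l)"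
proof (induction l arbitrary: k)
  case (Suc l)
  then show ?case using Suc.IH[of "k + 1"] by (simp add: algebra_simps)
qed simp

lemma sum_powi_eq_alt_sum:
  "(\<Sum>j\<in>{k..<k + int l}. (-1) powi (j + k) * of_int (g j)) = (of_int (alt_sum g k l) :: rat)"
proof (induction l arbitrary: k)
  case (Suc l)
  have "{k..<k + int (Suc l)} = insert k {k + 1..<k + 1 + int l}" by auto
  then have "(\<Sum>j\<in>{k..<k + int (Suc l)}. (-1) powi (j + k) * of_int (g j)) =
      (-1) powi (k + k) * of_int (g k) +
      (\<Sum>j\<in>{k + 1..<k + 1 + int l}. (-1) powi (j + k) * (of_int (g j) :: rat))"
    by simp
  also have "(\<Sum>j\<in>{k + 1..<k + 1 + int l}. (-1) powi (j + k) * (of_int (g j) :: rat)) =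
      - (\<Sum>j\<in>{k + 1..<k + 1 + int l}. (-1) powi (j + (k + 1)) * of_int (g j))"
    unfolding sum_negf[symmetric] by (intro sum.cong refl) (simp add: power_int_minus_left)
  also have "\<dots> = - of_int (alt_sum g (k + 1) l)"
    by (simp only: Suc.IH)
  finally show ?case by (simp add: power_int_minus_left)
qed simp

text \<open>A separate constant, so that evaluation by rewriting computes the tail only once.\<close>

definition push :: "'a::ab_group_add \<Rightarrow> 'a list \<Rightarrow> 'a list" where
  "push x xs = (x - hd xs) # xs"

text \<open>One pass yields the sums over all final segments of the interval, the empty one
  included, so a single evaluation covers every starting index.\<close>

primrec alt_sums :: "(int \<Rightarrow> 'a::ab_group_add) \<Rightarrow> int \<Rightarrow> nat \<Rightarrow> 'a list" where
  "alt_sums g k 0 = [0]"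
| "alt_sums g k (Suc l) = push (g k) (alt_sums g (k + 1) l)"

lemma hd_alt_sums: "hd (alt_sums g k l) = alt_sum g k l"
  by (induction l arbitrary: k) (auto simp: push_def)

lemma alt_sum_in_alt_sums: "i \<le> l \<Longrightarrow> alt_sum g (k + int i) (l - i) \<in> set (alt_sums g k l)"
proof (induction l arbitrary: k i)
  case (Suc l)
  show ?case
  proof (cases i)
    case 0
    then show ?thesis by (simp add: push_def hd_alt_sums)
  next
    case (Suc i')
    then have "alt_sum g (k + 1 + int i') (l - i') \<in> set (alt_sums g (k + 1) l)"
      using Suc.IH[of i' "k + 1"] Suc.prems by simp
    then show ?thesis using Suc by (simp add: push_def add.assoc)
  qed
qed simp

section \<open>Paired pentagonal exponents and periodic functions\<close>

text \<open>For \<open>f\<close> the coefficients of a series, this is, up to the sign belonging to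
  \<open>j\<close>, the contribution of the indices \<open>j\<close> and \<open>- j - 1\<close> to
  the \<open>n\<close>-th coefficient of its product with the theta sum. The two signs are
  opposite.\<close>

definition theta_diff :: "(int \<Rightarrow> 'a::minus) \<Rightarrow> int \<Rightarrow> int \<Rightarrow> 'a" where
  "theta_diff f n j = f (n - pent j) - f (n - pent j - (2 * j + 1))"

definition cyc :: "int list \<Rightarrow> int \<Rightarrow> int" where
  "cyc xs m = xs ! nat (m mod int (length xs))"

lemma cyc_cong: "m mod int (length xs) = m' mod int (length xs) \<Longrightarrow> cyc xs m = cyc xs m'"
  by (simp add: cyc_def)

lemma abs_cyc_le:
  assumes "xs \<noteq> []" "list_all (\<lambda>x. \<bar>x\<bar> \<le> R) xs"
  shows "\<bar>cyc xs m\<bar> \<le> R"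
proof -
  have "nat (m mod int (length xs)) < length xs"
    using assms(1) by (simp add: nat_less_iff)
  then show ?thesis using assms(2) by (auto simp: cyc_def list_all_length)
qed

lemma theta_diff_cyc_add_period:
  "theta_diff (cyc us) n (j + 2 * int (length us)) = theta_diff (cyc us) n j"
proof -
  define d where "d = int (length us)"
  have "(n - pent (j + 2 * d)) mod d = (n - pent j) mod d"
    by (simp add: pent_add_period mod_eq_dvd_iff)
  moreover have "(n - pent (j + 2 * d) - (2 * (j + 2 * d) + 1)) mod d = (n - pent j - (2 * j + 1)) mod d"
    by (simp add: pent_add_period mod_eq_dvd_iff)
  ultimately show ?thesis
    unfolding theta_diff_def d_def by (metis cyc_cong)
qed

lemma theta_diff_cyc_mod: "theta_diff (cyc us) (n mod int (length us)) = theta_diff (cyc us) n"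
  unfolding theta_diff_def
  by (intro ext arg_cong2[of _ _ _ _ "(-)"] cyc_cong) (auto intro: mod_diff_cong simp: mod_simps)

text \<open>If the alternating sum over one period vanishes, the alternating sums from an index to the
  end of its period form a periodic potential for \<open>h\<close>, so all alternating sums telescope.\<close>

lemma alt_sum_periodic_bound:
  fixes h :: "int \<Rightarrow> int"
  assumes per: "\<And>j. h (j + int p) = h j"
    and zero: "alt_sum h 0 p = 0" and p: "p > 0"
    and bound: "\<And>i. i \<le> p \<Longrightarrow> \<bar>alt_sum h (int i) (p - i)\<bar> \<le> R"
  shows "\<bar>alt_sum h k l\<bar> \<le> 2 * R"
proof -
  define Z where "Z j = alt_sum h (j mod int p) (p - nat (j mod int p))" for j
  have per_mult: "h (j + int p * int i) = h j" for i j
  proof (induction i)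
    case (Suc i)
    have "h (j + int p * int (Suc i)) = h (j + int p * int i + int p)"
      by (simp add: algebra_simps)
    then show ?case using Suc by (simp add: per)
  qed simp
  have per_mod: "h (j mod int p) = h j" for j
  proof (cases "j div int p \<ge> 0")
    case True
    then show ?thesis
      using per_mult[of "j mod int p" "nat (j div int p)"] by simp
  next
    case False
    then show ?thesis
      using per_mult[of j "nat (- (j div int p))"] by (simp add: minus_mult_div_eq_mod)
  qed
  have Z_bound: "\<bar>Z j\<bar> \<le> R" for j
    unfolding Z_def using bound[of "nat (j mod int p)"] p by (simp add: nat_le_iff less_imp_le)
  have "Z j + Z (j + 1) = h j" for j
  proof -
    define r where "r = nat (j mod int p)"
    have r: "j mod int p = int r" "r < p"
      using p by (auto simp: r_def nat_less_iff)
    have j1: "(j + 1) mod int p = (int r + 1) mod int p"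
      unfolding r(1)[symmetric] by (simp add: mod_simps)
    have pr: "p - r = Suc (p - Suc r)" using r(2) by simp
    have "alt_sum h (int r) (p - r) = h (int r) - alt_sum h (int r + 1) (p - Suc r)"
      unfolding pr by simp
    moreover have "Z (j + 1) = alt_sum h (int r + 1) (p - Suc r)"
    proof (cases "Suc r = p")
      \<comment> \<open>At the end of a period the remaining sum is empty, while
        \<open>Z (j + 1)\<close> restarts with a full period; \<open>zero\<close> identifies the
        two.\<close>
      case True
      then have "int r + 1 = int p" by simp
      then have "(j + 1) mod int p = 0" unfolding j1 by simp
      then show ?thesis using True zero by (simp add: Z_def)
    next
      case False
      then have "(j + 1) mod int p = int (Suc r)" unfolding j1 using r(2) by simp
      then show ?thesis by (simp add: Z_def add.commute del: of_nat_Suc) (simp add: add.commute)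
    qed
    ultimately show ?thesis
      using per_mod[of j] by (simp add: Z_def r(1))
  qed
  then have "alt_sum h k l = alt_sum (\<lambda>j. Z j + Z (j + 1)) k l" by simp
  also have "\<dots> = Z k - (-1) ^ l * Z (k + int l)" by (rule alt_sum_telescope)
  finally have "alt_sum h k l = Z k - (-1) ^ l * Z (k + int l)" .
  moreover have "\<bar>(-1) ^ l * Z (k + int l)\<bar> \<le> R"
    using Z_bound by (simp add: abs_mult)
  ultimately show ?thesis using Z_bound[of k] by linarith
qed

text \<open>An executable condition: by periodicity in \<open>n\<close> and in \<open>j\<close>, one
  residue system for \<open>n\<close> and one period of \<open>j\<close> cover everything. The head
  of the list is the sum over the whole period.\<close>

definition per_ok :: "int list \<Rightarrow> int \<Rightarrow> bool" where
  "per_ok us R \<longleftrightarrow>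
     list_all (\<lambda>n. hd (alt_sums (theta_diff (cyc us) n) 0 (2 * length us)) = 0 \<and>
       list_all (\<lambda>x. \<bar>x\<bar> \<le> R) (alt_sums (theta_diff (cyc us) n) 0 (2 * length us)))
     [0..int (length us) - 1]"

lemma per_okD:
  assumes "per_ok us R" "us \<noteq> []"
  shows "\<bar>alt_sum (theta_diff (cyc us) n) k l\<bar> \<le> 2 * R"
proof -
  define n' where "n' = n mod int (length us)"
  have "n' \<in> set [0..int (length us) - 1]"
    using assms(2) by (simp add: n'_def)
  then have hd0: "hd (alt_sums (theta_diff (cyc us) n') 0 (2 * length us)) = 0"
    and all: "\<And>x. x \<in> set (alt_sums (theta_diff (cyc us) n') 0 (2 * length us)) \<Longrightarrow> \<bar>x\<bar> \<le> R"
    using assms(1) unfolding per_ok_def list_all_iff by blast+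
  have "\<bar>alt_sum (theta_diff (cyc us) n') k l\<bar> \<le> 2 * R"
  proof (rule alt_sum_periodic_bound[where p = "2 * length us"])
    show "theta_diff (cyc us) n' (j + int (2 * length us)) = theta_diff (cyc us) n' j" for j
      using theta_diff_cyc_add_period[of us n' j] by simp
    show "alt_sum (theta_diff (cyc us) n') 0 (2 * length us) = 0"
      using hd0 by (simp add: hd_alt_sums)
    show "2 * length us > 0" using assms(2) by simp
    show "\<bar>alt_sum (theta_diff (cyc us) n') (int i) (2 * length us - i)\<bar> \<le> R" if "i \<le> 2 * length us" for i
      using all alt_sum_in_alt_sums[OF that, of "theta_diff (cyc us) n'" 0] by simp
  qed
  then show ?thesis by (simp add: n'_def theta_diff_cyc_mod)
qed


section \<open>Backward differences and partitions into parts 1, b, c\<close>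

text \<open>On coefficient functions this is multiplication by \<open>1 - fps_X ^ a\<close>.
  Arguments are integers, so that shifts below 0 need no case distinction.\<close>

definition backdiff :: "int \<Rightarrow> (int \<Rightarrow> 'a::ab_group_add) \<Rightarrow> int \<Rightarrow> 'a" where
  "backdiff a f m = f m - f (m - a)"

definition trunc :: "(int \<Rightarrow> 'a::zero) \<Rightarrow> int \<Rightarrow> 'a" where
  "trunc f m = (if m < 0 then 0 else f m)"

definition int_nth :: "'a::zero fps \<Rightarrow> int \<Rightarrow> 'a" where
  "int_nth F = trunc (\<lambda>m. fps_nth F (nat m))"

lemma int_nth_neg: "m < 0 \<Longrightarrow> int_nth F m = 0"
  by (simp add: int_nth_def trunc_def)

lemma int_nth_mult_one_minus_X_power:
  fixes F :: "'a::comm_ring_1 fps"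
  shows "int_nth (F * (1 - fps_X ^ a)) = backdiff (int a) (int_nth F)"
proof
  fix m
  have "fps_nth (F * (1 - fps_X ^ a)) i = fps_nth F i - (if i < a then 0 else fps_nth F (i - a))" for i
    by (simp add: algebra_simps fps_X_power_mult_right_nth)
  then show "int_nth (F * (1 - fps_X ^ a)) m = backdiff (int a) (int_nth F) m"
    by (auto simp: int_nth_def trunc_def backdiff_def nat_less_iff nat_diff_distrib)
qed

text \<open>Since \<open>f\<close> vanishes below 0, \<open>f m\<close> is the sum of its
  differences at \<open>m\<close>, \<open>m - a\<close>, \<open>m - 2 * a\<close> and so on.\<close>

lemma nonneg_if_backdiff_nonneg:
  fixes f :: "int \<Rightarrow> 'a::linordered_idom"
  assumes "a > 0" "\<And>m. m < 0 \<Longrightarrow> f m = 0" "\<And>m. backdiff a f m \<ge> 0"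
  shows "f m \<ge> 0"
proof (induction "nat m" arbitrary: m rule: less_induct)
  case less
  show ?case
  proof (cases "m < 0")
    case False
    have "f (m - a) \<ge> 0"
    proof (cases "m < a")
      case False
      with \<open>a > 0\<close> \<open>\<not> m < 0\<close> show ?thesis by (intro less) auto
    qed (simp add: assms(2))
    then show ?thesis using assms(3)[of m] by (simp add: backdiff_def)
  qed (simp add: assms(2))
qed

text \<open>The triple difference is a recurrence of order \<open>a + b + c\<close> with leading
  coefficient 1, so as many consecutive values determine all later ones.\<close>

lemma backdiff3_eq_unique:
  fixes f h :: "int \<Rightarrow> 'a::ab_group_add"
  assumes pos: "a > 0" "b > 0" "c > 0"
    and f: "\<And>m. m > 0 \<Longrightarrow> backdiff a (backdiff b (backdiff c f)) m = 0"
    and h: "\<And>m. m > 0 \<Longrightarrow> backdiff a (backdiff b (backdiff c h)) m = 0"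
    and init: "\<And>m. \<lbrakk>- (a + b + c) < m; m \<le> 0\<rbrakk> \<Longrightarrow> f m = h m"
    and m: "- (a + b + c) < m"
  shows "f m = h m"
  using m
proof (induction "nat (m + (a + b + c))" arbitrary: m rule: less_induct)
  case less
  show ?case
  proof (cases "m \<le> 0")
    case False
    have IH: "f (m - i) = h (m - i)" if "0 < i" "i \<le> a + b + c" for i
      by (rule less.hyps) (use that False in auto)
    have "f m = f (m - a) + f (m - b) + f (m - c) - f (m - (a + b)) - f (m - (a + c))
        - f (m - (b + c)) + f (m - (a + b + c))"
      using f[of m] False by (simp add: backdiff_def algebra_simps)
    also have "\<dots> = h (m - a) + h (m - b) + h (m - c) - h (m - (a + b)) - h (m - (a + c))
        - h (m - (b + c)) + h (m - (a + b + c))"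
      using pos by (simp add: IH)
    also have "\<dots> = h m"
      using h[of m] False by (simp add: backdiff_def algebra_simps)
    finally show ?thesis .
  qed (use init less.prems in auto)
qed

definition qpoly :: "int list \<Rightarrow> int list \<Rightarrow> int \<Rightarrow> int" where
  "qpoly us vs m = (2 * m + (1 + int (length us) + int (length vs)))\<^sup>2 + cyc us m + cyc vs m"

text \<open>Each periodic part is killed by the difference of its own period, and three differences
  kill a polynomial of degree 2.\<close>

lemma backdiff3_qpoly: "backdiff 1 (backdiff (int (length us)) (backdiff (int (length vs)) (qpoly us vs))) m = 0"
proof -
  define b c where "b = int (length us)" and "c = int (length vs)"
  have u: "cyc us (x - b) = cyc us x" and v: "cyc vs (x - c) = cyc vs x" for x
    by (auto simp: b_def c_def intro!: cyc_cong)
  have v': "cyc vs (x - b - c) = cyc vs (x - b)" for x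
    by (rule v)
  have u': "cyc us (x - b - c) = cyc us (x - c)" for x
    using u[of "x - c"] by (simp add: algebra_simps)
  show ?thesis
    unfolding backdiff_def qpoly_def b_def[symmetric] c_def[symmetric] v v' u' u
    by (simp add: power2_eq_square algebra_simps)
qed

definition recip_prod :: "nat \<Rightarrow> nat \<Rightarrow> rat fps" where
  "recip_prod b c = 1 / ((1 - fps_X ^ 1) * (1 - fps_X ^ b) * (1 - fps_X ^ c))"

lemma recip_prod_mult:
  assumes "b > 0" "c > 0"
  shows "recip_prod b c * (1 - fps_X ^ c) * (1 - fps_X ^ b) * (1 - fps_X ^ 1) = 1"
proof -
  define D :: "rat fps" where "D = (1 - fps_X ^ 1) * (1 - fps_X ^ b) * (1 - fps_X ^ c)"
  have "fps_nth D 0 \<noteq> 0"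
    using assms by (simp add: D_def)
  moreover have "recip_prod b c = 1 / D"
    by (simp only: recip_prod_def D_def)
  ultimately have "recip_prod b c * D = 1"
    by (simp add: fps_divide_unit inverse_mult_eq_1)
  then show ?thesis by (simp add: D_def algebra_simps)
qed

lemma backdiff3_recip_prod:
  assumes "b > 0" "c > 0"
  shows "backdiff 1 (backdiff (int b) (backdiff (int c) (int_nth (recip_prod b c)))) m = (if m = 0 then 1 else 0)"
proof -
  have "backdiff 1 (backdiff (int b) (backdiff (int c) (int_nth (recip_prod b c)))) = int_nth 1"
    using arg_cong[OF recip_prod_mult[OF assms], of int_nth] unfolding int_nth_mult_one_minus_X_power of_nat_1 .
  then show ?thesis by (simp add: int_nth_def trunc_def)
qed

lemma backdiff_commute: "backdiff a (backdiff b f) = backdiff b (backdiff a f)"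
  by (rule ext) (simp add: backdiff_def algebra_simps)

text \<open>Cancelling the factor \<open>1 - fps_X\<close> leaves a series with nonnegative
  coefficients. Formally, \<open>backdiff 1\<close> is moved innermost and the two outer differences
  are undone one after the other.\<close>

lemma int_nth_recip_prod_mono:
  assumes "b > 0" "c > 0"
  shows "int_nth (recip_prod b c) (m - 1) \<le> int_nth (recip_prod b c) m"
proof -
  define f where "f = int_nth (recip_prod b c)"
  have neg: "f m = 0" if "m < 0" for m
    using that by (simp add: f_def int_nth_neg)
  have "backdiff (int b) (backdiff (int c) (backdiff 1 f)) m \<ge> 0" for m
    using backdiff3_recip_prod[OF assms, of m] unfolding f_def
    by (metis backdiff_commute order.refl zero_le_one)
  then have "backdiff (int c) (backdiff 1 f) m \<ge> 0" for m
    by (rule nonneg_if_backdiff_nonneg[rotated 2]) (use assms neg in \<open>auto simp: backdiff_def\<close>)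
  then have "backdiff 1 f m \<ge> 0"
    by (rule nonneg_if_backdiff_nonneg[rotated 2]) (use assms neg in \<open>auto simp: backdiff_def\<close>)
  then show ?thesis by (simp add: backdiff_def f_def)
qed

text \<open>Below \<open>0\<close> the quasi-polynomial vanishes on a window of length \<open>b + c\<close>, one less than the order
  of the recurrence, so that \<open>1 + b + c\<close> consecutive values determine it.\<close>

definition init_ok :: "int list \<Rightarrow> int list \<Rightarrow> bool" where
  "init_ok us vs \<longleftrightarrow> us \<noteq> [] \<and> vs \<noteq> [] \<and>
     qpoly us vs 0 = 8 * int (length us) * int (length vs) \<and>
     list_all (\<lambda>m. qpoly us vs m = 0) [- int (length us) - int (length vs)..- 1]"

text \<open>Both functions satisfy the same recurrence at positive arguments and agree on the window
  of \<open>1 + b + c\<close> arguments ending at 0. The truncation is there because the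
  quasi-polynomial need not vanish further down.\<close>

lemma int_nth_recip_prod_eq_qpoly:
  assumes "init_ok us vs"
  shows "8 * of_nat (length us) * of_nat (length vs) * int_nth (recip_prod (length us) (length vs)) m =
    of_int (trunc (qpoly us vs) m)"
proof (cases "m < 0")
  case False
  define b c where "b = int (length us)" and "c = int (length vs)"
  define C :: rat where "C = 8 * of_nat (length us) * of_nat (length vs)"
  have pos: "b > 0" "c > 0" "length us > 0" "length vs > 0"
    using assms by (auto simp: init_ok_def b_def c_def)
  have "C * int_nth (recip_prod (length us) (length vs)) m = of_int (qpoly us vs m)"
  proof (rule backdiff3_eq_unique[where a = 1 and b = b and c = c
      and f = "\<lambda>m. C * int_nth (recip_prod (length us) (length vs)) m" and h = "\<lambda>m. of_int (qpoly us vs m)"])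
    show "backdiff 1 (backdiff b (backdiff c (\<lambda>m. C * int_nth (recip_prod (length us) (length vs)) m))) m = 0" if "m > 0" for m
      using backdiff3_recip_prod[OF pos(3,4), of m] that
      by (simp add: backdiff_def b_def c_def flip: right_diff_distrib)
    show "backdiff 1 (backdiff b (backdiff c (\<lambda>m. of_int (qpoly us vs m) :: rat))) m = 0" if "m > 0" for m
      using backdiff3_qpoly[of us vs m]
      by (simp add: backdiff_def b_def c_def flip: of_int_diff)
    show "C * int_nth (recip_prod (length us) (length vs)) m = of_int (qpoly us vs m)"
      if m: "- (1 + b + c) < m" "m \<le> 0" for m
    proof (cases "m = 0")
      case True
      have "fps_nth (recip_prod (length us) (length vs)) 0 = 1"
        using arg_cong[OF recip_prod_mult[OF pos(3,4)], of "\<lambda>F. fps_nth F 0"] pos by simp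
      then show ?thesis
        using True assms by (simp add: C_def init_ok_def int_nth_def trunc_def)
    next
      case False
      then have "m \<in> set [- int (length us) - int (length vs)..- 1]"
        using m by (auto simp: b_def c_def)
      then have "qpoly us vs m = 0"
        using assms unfolding init_ok_def list_all_iff by blast
      then show ?thesis using False m by (simp add: int_nth_neg)
    qed
  qed (use pos False in auto)
  then show ?thesis using False by (simp add: C_def trunc_def)
qed (simp add: trunc_def int_nth_neg)

lemma trunc_qpoly_mono:
  assumes "init_ok us vs" "i \<le> m"
  shows "trunc (qpoly us vs) i \<le> trunc (qpoly us vs) m"
  using assms(2)
proof (induction m rule: int_ge_induct)
  case (step m)
  have pos: "length us > 0" "length vs > 0"
    using assms(1) by (auto simp: init_ok_def)
  have "8 * of_nat (length us) * of_nat (length vs) * int_nth (recip_prod (length us) (length vs)) (m + 1 - 1) \<le>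
      8 * of_nat (length us) * of_nat (length vs) * int_nth (recip_prod (length us) (length vs)) (m + 1)"
    by (intro mult_left_mono int_nth_recip_prod_mono[OF pos]) auto
  then have "trunc (qpoly us vs) m \<le> trunc (qpoly us vs) (m + 1)"
    unfolding int_nth_recip_prod_eq_qpoly[OF assms(1)] by simp
  then show ?case using step by simp
qed simp

section \<open>Coefficients as finite alternating sums\<close>

lemma nth_mult_truncated_theta:
  assumes "k \<ge> 1"
  shows "fps_nth (F * truncated_theta (3/2) (1/2) k) n =
    (\<Sum>j\<in>{k..<k + int (Suc n)}. (-1) powi (j + k) * theta_diff (int_nth F) (int n) j)"
proof -
  \<comment> \<open>By \<open>pent_ge\<close>, every \<open>j\<close> with
    \<open>pent j \<le> n\<close> satisfies \<open>\<bar>j\<bar> \<le> n < M\<close>.\<close>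
  define M where "M = k + int (Suc n)"
  define S where "S = {j. j \<notin> {-k..k-1}}"
  define E where "E i = {j\<in>S. theta_exponent (3/2) (1/2) j = i}" for i
  have finE: "finite (E i)" for i
    unfolding E_def by (rule finite_theta_exponent_pentagonal)
  define t where "t j = (-1) powi (j + k) * int_nth F (int n - pent j)" for j
  have "fps_nth (F * truncated_theta (3/2) (1/2) k) n =
      fps_nth (truncated_theta (3/2) (1/2) k * F) n"
    by (simp add: mult.commute)
  also have "\<dots> = (\<Sum>i\<in>{0..n}. (\<Sum>j\<in>E i. (-1) powi (j + k)) * fps_nth F (n - i))"
    by (simp add: fps_mult_nth truncated_theta_pentagonal_nth E_def S_def)
  also have "\<dots> = (\<Sum>i\<in>{0..n}. \<Sum>j\<in>E i. t j)"
    unfolding sum_distrib_right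
  proof (intro sum.cong refl)
    fix i j assume "i \<in> {0..n}" "j \<in> E i"
    then have "pent j = int i" and "i \<le> n"
      by (auto simp: E_def simp flip: theta_exponent_eq_pent)
    then show "(-1) powi (j + k) * fps_nth F (n - i) = t j"
      by (simp add: t_def int_nth_def trunc_def nat_diff_distrib)
  qed
  also have "\<dots> = (\<Sum>j\<in>(\<Union>i\<in>{0..n}. E i). t j)"
    by (rule sum.UNION_disjoint[symmetric]) (use finE in \<open>auto simp: E_def\<close>)
  \<comment> \<open>The index set becomes invariant under \<open>j \<mapsto> - j - 1\<close>; the
    added indices have \<open>pent j > n\<close> and contribute 0.\<close>
  also have "\<dots> = (\<Sum>j\<in>{k..<M} \<union> {-M..<-k}. t j)"
  proof (rule sum.mono_neutral_left)
    show "(\<Union>i\<in>{0..n}. E i) \<subseteq> {k..<M} \<union> {-M..<-k}"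
    proof
      fix j assume "j \<in> (\<Union>i\<in>{0..n}. E i)"
      then have "j \<in> S" "pent j \<le> int n"
        by (auto simp: E_def simp flip: theta_exponent_eq_pent)
      then show "j \<in> {k..<M} \<union> {-M..<-k}"
        using pent_ge[of j] assms unfolding M_def S_def by auto
    qed
    show "\<forall>j\<in>{k..<M} \<union> {-M..<-k} - (\<Union>i\<in>{0..n}. E i). t j = 0"
    proof
      fix j assume j: "j \<in> {k..<M} \<union> {-M..<-k} - (\<Union>i\<in>{0..n}. E i)"
      then have "j \<in> S" using assms by (auto simp: S_def)
      with j have "\<not> theta_exponent (3/2) (1/2) j \<le> n" by (auto simp: E_def)
      then have "int n < pent j" by (simp flip: theta_exponent_eq_pent)
      then show "t j = 0" by (simp add: t_def int_nth_neg)
    qed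
  qed auto
  also have "\<dots> = (\<Sum>j\<in>{k..<M}. t j) + (\<Sum>j\<in>{-M..<-k}. t j)"
    by (rule sum.union_disjoint) (use assms in auto)
  also have "(\<Sum>j\<in>{-M..<-k}. t j) = (\<Sum>j\<in>{k..<M}. t (- j - 1))"
    by (rule sum.reindex_bij_witness[of _ "\<lambda>j. - j - 1" "\<lambda>j. - j - 1"]) auto
  also have "(\<Sum>j\<in>{k..<M}. t j) + \<dots> = (\<Sum>j\<in>{k..<M}. (-1) powi (j + k) * theta_diff (int_nth F) (int n) j)"
    unfolding sum.distrib[symmetric]
  proof (intro sum.cong refl)
    fix j
    have "even (- j - 1 + k) \<longleftrightarrow> odd (j + k)" by presburger
    then have "(-1 :: rat) powi (- j - 1 + k) = - ((-1) powi (j + k))"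
      by (simp add: power_int_minus_left)
    then show "t j + t (- j - 1) = (-1) powi (j + k) * theta_diff (int_nth F) (int n) j"
      by (simp add: t_def theta_diff_def pent_reflect algebra_simps)
  qed
  finally show ?thesis by (simp add: M_def)
qed

text \<open>Scaling by \<open>8 b c\<close> turns the rational coefficient into an integer that can
  be evaluated.\<close>

lemma gamma_eq_alt_sum:
  assumes "init_ok us vs" "k \<ge> 1"
  shows "8 * of_nat (length us) * of_nat (length vs) *
      gamma 1 (length us) (length vs) (3/2) (1/2) k n =
    of_int (alt_sum (theta_diff (trunc (qpoly us vs)) (int n)) k (Suc n))"
proof -
  define C :: rat where "C = 8 * of_nat (length us) * of_nat (length vs)"
  define F where "F = recip_prod (length us) (length vs)"
  have C: "C * int_nth F m = of_int (trunc (qpoly us vs) m)" for m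
    using int_nth_recip_prod_eq_qpoly[OF assms(1)] by (simp add: C_def F_def)
  have "C * gamma 1 (length us) (length vs) (3/2) (1/2) k n =
      C * fps_nth (F * truncated_theta (3/2) (1/2) k) n"
    by (simp add: gamma_def F_def recip_prod_def)
  also have "\<dots> = (\<Sum>j\<in>{k..<k + int (Suc n)}. (-1) powi (j + k) *
      (C * theta_diff (int_nth F) (int n) j))"
    unfolding nth_mult_truncated_theta[OF assms(2)] sum_distrib_left
    by (intro sum.cong refl) (simp add: algebra_simps)
  also have "(\<lambda>j. C * theta_diff (int_nth F) (int n) j) =
      (\<lambda>j. of_int (theta_diff (trunc (qpoly us vs)) (int n) j))"
    by (simp add: theta_diff_def right_diff_distrib C)
  finally show ?thesis
    unfolding C_def sum_powi_eq_alt_sum .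
qed


section \<open>Polynomial lower bounds for the main term\<close>

text \<open>In this and the next three bounds, even and odd refer to \<open>K - k\<close>, where
  \<open>K\<close> is the last index with \<open>pent K \<le> n\<close>; in the partial cases the
  second argument of \<open>f\<close> in the pair at \<open>K\<close> is negative. Here
  \<open>y\<close> is \<open>2 * (n - pent K) + s\<close>. Completing the square in \<open>y\<close>
  leaves a polynomial in \<open>k - 1\<close> and \<open>K - k - 1\<close> with nonnegative
  coefficients.\<close>

lemma main_term_even_partial:
  fixes k K y :: int
  assumes "k \<ge> 1" "K \<ge> k + 1"
  shows "4 * (K\<^sup>2 + K - 2) \<le>
    4 * (- (K - k) * (3 * K\<^sup>2 + K + y) + 3 * K ^ 3 - 2 * K - 3 * k ^ 3 + 2 * k) + y\<^sup>2"
proof -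
  define t where "t = K - (k + 1)"
  define r where "r = k - 1"
  have eqs: "K = r + t + 2" "k = r + 1" and nn: "t \<ge> 0" "r \<ge> 0"
    using assms by (auto simp: t_def r_def)
  have "4 * (- (K - k) * (3 * K\<^sup>2 + K + y) + 3 * K ^ 3 - 2 * K - 3 * k ^ 3 + 2 * k) + y\<^sup>2
      - 4 * (K\<^sup>2 + K - 2) =
    (y - 2 * (K - k))\<^sup>2 + 4 * (9 * r + 5 * r * r + 6 * r * r * t + 15 * r * t + 3 * r * t * t)"
    unfolding eqs by (simp add: power2_eq_square power3_eq_cube algebra_simps)
  moreover have "\<dots> \<ge> 0"
    using nn by (intro add_nonneg_nonneg mult_nonneg_nonneg) auto
  ultimately show ?thesis by linarith
qed

text \<open>With \<open>M = K + 1\<close>, the right side increases in \<open>N\<close>, so the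
  least admissible \<open>N\<close> decides.\<close>

lemma main_term_even_full:
  fixes k M N :: int
  assumes "k \<ge> 1" "M \<ge> k + 2" "N \<ge> 3 * M\<^sup>2 - M"
  shows "M\<^sup>2 - M - 2 \<le> (M + k) * N - 3 * M ^ 3 + 2 * M - 3 * k ^ 3 + 2 * k"
proof -
  define t where "t = M - (k + 2)"
  define r where "r = k - 1"
  have eqs: "M = r + t + 3" "k = r + 1" and nn: "t \<ge> 0" "r \<ge> 0"
    using assms by (auto simp: t_def r_def)
  have "(M + k) * (3 * M\<^sup>2 - M) \<le> (M + k) * N"
    using assms by (intro mult_left_mono) auto
  moreover have "(M + k) * (3 * M\<^sup>2 - M) - 3 * M ^ 3 + 2 * M - 3 * k ^ 3 + 2 * k - (M\<^sup>2 - M - 2) =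
    16 + 25 * r + 9 * r * r + 6 * r * r * t + 19 * r * t + 3 * r * t * t + 8 * t + t * t"
    unfolding eqs by (simp add: power2_eq_square power3_eq_cube algebra_simps)
  moreover have "\<dots> \<ge> 0"
    using nn by (intro add_nonneg_nonneg mult_nonneg_nonneg) auto
  ultimately show ?thesis by linarith
qed

text \<open>Here the right side decreases in \<open>N\<close>, so the greatest admissible
  \<open>N\<close> decides.\<close>

lemma main_term_odd_full:
  fixes k M N :: int
  assumes "k \<ge> 1" "M \<ge> k + 2" "M \<ge> 9" "N \<le> 3 * M\<^sup>2 + M + 10"
  shows "M\<^sup>2 - M - 2 \<le> - (M - k) * N + 3 * M ^ 3 - 2 * M - 3 * k ^ 3 + 2 * k"
proof -
  have "(M - k) * N \<le> (M - k) * (3 * M\<^sup>2 + M + 10)"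
    using assms by (intro mult_left_mono) auto
  moreover have "- (M - k) * (3 * M\<^sup>2 + M + 10) + 3 * M ^ 3 - 2 * M - 3 * k ^ 3 + 2 * k
      - (M\<^sup>2 - M - 2) \<ge> 0"
  proof (cases "k = 1")
    \<comment> \<open>For \<open>k = 1\<close> the difference is \<open>M * M - 10 * M + 11\<close>,
      which is negative at \<open>M = 8\<close>; this is where \<open>M \<ge> 9\<close>
      enters.\<close>
    case True
    define t where "t = M - 9"
    have eqs: "M = t + 9" "k = 1" and "t \<ge> 0"
      using assms True by (auto simp: t_def)
    have "- (M - k) * (3 * M\<^sup>2 + M + 10) + 3 * M ^ 3 - 2 * M - 3 * k ^ 3 + 2 * k
        - (M\<^sup>2 - M - 2) = 2 + 8 * t + t * t"
      unfolding eqs by (simp add: power2_eq_square power3_eq_cube algebra_simps)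
    also have "\<dots> \<ge> 0" using \<open>t \<ge> 0\<close> by simp
    finally show ?thesis .
  next
    case False
    define t where "t = M - (k + 2)"
    define r where "r = k - 2"
    have eqs: "M = r + t + 4" "k = r + 2" and nn: "t \<ge> 0" "r \<ge> 0"
      using assms False by (auto simp: t_def r_def)
    have "- (M - k) * (3 * M\<^sup>2 + M + 10) + 3 * M ^ 3 - 2 * M - 3 * k ^ 3 + 2 * k
        - (M\<^sup>2 - M - 2) =
      30 + 51 * r + 11 * r * r + 6 * r * r * t + 33 * r * t + 3 * r * t * t + 23 * t + 4 * t * t"
      unfolding eqs by (simp add: power2_eq_square power3_eq_cube algebra_simps)
    moreover have "\<dots> \<ge> 0"
      using nn by (intro add_nonneg_nonneg mult_nonneg_nonneg) auto
    ultimately show ?thesis by linarith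
  qed
  ultimately show ?thesis by linarith
qed

lemma main_term_odd_partial:
  fixes k K y :: int
  assumes "k \<ge> 1" "K \<ge> k + 1" "K \<ge> 8" "0 \<le> y" "y \<le> 4 * K + 12"
  shows "4 * (K\<^sup>2 + K - 2) \<le>
    4 * ((K + k) * (3 * K\<^sup>2 + K + y) - 3 * K ^ 3 + 2 * K - 3 * k ^ 3 + 2 * k) - y\<^sup>2"
proof -
  define X where "X = (K + k) * (3 * K\<^sup>2 + K) - 3 * K ^ 3 + 2 * K - 3 * k ^ 3 + 2 * k - (K\<^sup>2 + K - 2)"
  \<comment> \<open>The part depending on \<open>y\<close> is
    \<open>y * (4 * k + 4 * K - y)\<close>. After this estimate it is nonnegative for
    \<open>k \<ge> 3\<close>; for \<open>k = 1\<close> and \<open>k = 2\<close> the cubic part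
    \<open>X\<close> absorbs it.\<close>
  have "y * (4 * k - 12) \<le> y * (4 * k + 4 * K - y)"
    using assms by (intro mult_left_mono) auto
  moreover have "4 * X + y * (4 * k - 12) \<ge> 0"
  proof -
    consider "k = 1" | "k = 2" | "k \<ge> 3" using assms by linarith
    then show ?thesis
    proof cases
      case 1
      define t where "t = K - 8"
      have eqs: "K = t + 8" and "t \<ge> 0" using assms by (auto simp: t_def)
      have "X - (8 * K + 24) = 121 + 42 * t + 3 * t * t"
        unfolding X_def eqs 1 by (simp add: power2_eq_square power3_eq_cube algebra_simps)
      moreover have "3 * t * t \<ge> 0" by simp
      ultimately have "4 * X - 8 * y \<ge> 0" using \<open>t \<ge> 0\<close> assms by linarith
      then show ?thesis using 1 by simp
    next
      case 2
      define t where "t = K - 8"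
      have eqs: "K = t + 8" and "t \<ge> 0" using assms by (auto simp: t_def)
      have "X - (4 * K + 12) = 346 + 95 * t + 6 * t * t"
        unfolding X_def eqs 2 by (simp add: power2_eq_square power3_eq_cube algebra_simps)
      moreover have "6 * t * t \<ge> 0" by simp
      ultimately have "4 * X - 4 * y \<ge> 0" using \<open>t \<ge> 0\<close> assms by linarith
      then show ?thesis using 2 by simp
    next
      case 3
      define t where "t = K - (k + 1)"
      define r where "r = k - 1"
      have eqs: "K = r + t + 2" "k = r + 1" and nn: "t \<ge> 0" "r \<ge> 0"
        using assms by (auto simp: t_def r_def)
      have "X = 17 + 21 * r + 7 * r * r + 6 * r * r * t + 19 * r * t + 3 * r * t * t + 14 * t + 3 * t * t"
        unfolding X_def eqs by (simp add: power2_eq_square power3_eq_cube algebra_simps)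
      also have "\<dots> \<ge> 0"
        using nn by (intro add_nonneg_nonneg mult_nonneg_nonneg) auto
      finally have "X \<ge> 0" .
      then show ?thesis using 3 assms by simp
    qed
  qed
  moreover have "4 * ((K + k) * (3 * K\<^sup>2 + K + y) - 3 * K ^ 3 + 2 * K - 3 * k ^ 3 + 2 * k) - y\<^sup>2
      - 4 * (K\<^sup>2 + K - 2) = 4 * X + y * (4 * k + 4 * K - y)"
    by (simp add: X_def power2_eq_square power3_eq_cube algebra_simps)
  ultimately show ?thesis by linarith
qed

text \<open>The cubic \<open>A\<close> makes the alternating sum of the quadratic part telescope.\<close>

lemma theta_diff_square:
  fixes A :: "int \<Rightarrow> int" and n s :: int
  defines "A \<equiv> \<lambda>j. j * (2 * n + s) - 3 * j ^ 3 + 2 * j"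
  shows "theta_diff (\<lambda>m. (2 * m + s)\<^sup>2) n j = 4 * (A j + A (j + 1))"
proof -
  have "theta_diff (\<lambda>m. (2 * m + s)\<^sup>2) n j =
      4 * (2 * j + 1) * (2 * n + s - 2 * pent j - (2 * j + 1))"
    by (simp add: theta_diff_def power2_eq_square algebra_simps)
  also have "\<dots> = 4 * (A j + A (j + 1))"
    unfolding two_pent A_def by (simp add: power2_eq_square power3_eq_cube algebra_simps)
  finally show ?thesis .
qed

section \<open>Nonnegativity for large n\<close>

lemma pent_interval:
  assumes "0 \<le> n"
  obtains K where "K \<ge> 0" "pent K \<le> n" "n < pent (K + 1)"
proof -
  define P where "P i \<longleftrightarrow> n < pent (int i)" for i
  have "P (Suc (nat n))"
    using pent_ge[of "int (Suc (nat n))"] assms by (simp add: P_def)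
  moreover have "\<not> P 0" using assms by (simp add: P_def pent_def)
  ultimately obtain i where "\<not> P i" "P (Suc i)"
    using nat_induct[of "\<lambda>i. \<not> P i"] by blast
  then show thesis by (intro that[of "int i"]) (auto simp: P_def add.commute)
qed

text \<open>If \<open>K < k\<close>, all terms vanish; if \<open>K = k\<close>, one term is left and
  \<open>q_mono\<close> applies. If \<open>K > k\<close>, all pairs before \<open>K\<close> lie in
  range, so the telescoped squares are compared with the error \<open>R0 + R1\<close>.\<close>

lemma alt_sum_theta_diff_nonneg:
  fixes q w :: "int \<Rightarrow> int"
  assumes q: "\<And>m. m \<ge> 0 \<Longrightarrow> q m = (2 * m + s)\<^sup>2 + w m"
    and q_neg: "\<And>m. m < 0 \<Longrightarrow> q m = 0"
    and q_mono: "\<And>i m. i \<le> m \<Longrightarrow> q i \<le> q m"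
    and w: "\<And>m. \<bar>w m\<bar> \<le> R0"
    and alt_sum_w: "\<And>l. \<bar>alt_sum (theta_diff w n) k l\<bar> \<le> R1"
    and R: "R0 + R1 \<le> 4 * (K0\<^sup>2 + K0 - 2)"
    and K0: "8 \<le> K0" "pent K0 \<le> n"
    and s: "0 \<le> s" "s \<le> 12"
    and k: "1 \<le> k"
    and L: "n < pent (k + int L)"
  shows "0 \<le> alt_sum (theta_diff q n) k L"
proof -
  define g where "g = theta_diff q n"
  define N where "N = 2 * n + s"
  define A where "A j = j * N - 3 * j ^ 3 + 2 * j" for j :: int
  have "0 \<le> n" using K0 pent_ge[of K0] by linarith
  then obtain K where K: "K \<ge> 0" "pent K \<le> n" "n < pent (K + 1)"
    by (rule pent_interval)
  have K0K: "K0 \<le> K"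
  proof (rule ccontr)
    assume "\<not> K0 \<le> K"
    then have "pent (K + 1) \<le> pent K0" using K(1) by (intro pent_mono) auto
    then show False using K K0 by linarith
  qed
  have g_0: "g j = 0" if "K + 1 \<le> j" for j
  proof -
    have "pent (K + 1) \<le> pent j" using that K by (intro pent_mono) auto
    then show ?thesis using K that by (simp add: g_def theta_diff_def q_neg)
  qed
  define m where "m = n - pent K"
  have m: "0 \<le> m" "m \<le> 3 * K + 1"
    using K by (auto simp: m_def pent_add1)
  have N: "N = 3 * K\<^sup>2 + K + (2 * m + s)"
    using two_pent[of K] by (simp add: N_def m_def)
  have gK: "g K = q m - q (m - (2 * K + 1))"
    by (simp add: g_def theta_diff_def m_def)
  consider "K < k" | "K = k" | "k < K" by linarith
  then show ?thesis
  proof cases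
    case 1
    then have "alt_sum g k L = 0" by (intro alt_sum_eq_0 g_0) auto
    then show ?thesis by (simp add: g_def)
  next
    case 2
    have "L \<noteq> 0"
      using L K 2 by (intro notI) simp
    then have "alt_sum g k L = alt_sum g k 1"
      using 2 by (intro alt_sum_truncate g_0) auto
    also have "\<dots> = q m - q (m - (2 * K + 1))" using gK 2 by simp
    also have "\<dots> \<ge> 0" using q_mono K(1) by simp
    finally show ?thesis by (simp add: g_def)
  next
    case 3
    define l where "l = nat (K - k)"
    have l: "int l = K - k" "k + int l = K" using 3 by (auto simp: l_def)
    have "\<not> L < Suc l"
    proof
      assume "L < Suc l"
      then have "pent (k + int L) \<le> pent K" using k l by (intro pent_mono) auto
      then show False using L K by linarith
    qed
    then have "alt_sum g k L = alt_sum g k (Suc l)"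
      using l by (intro alt_sum_truncate g_0) auto
    also have "Suc l = l + 1" by simp
    also have "alt_sum g k (l + 1) = alt_sum g k l + (-1) ^ l * g K"
      unfolding alt_sum_append l(2) by simp
    finally have sum_split: "alt_sum g k L = alt_sum g k l + (-1) ^ l * g K" .

    \<comment> \<open>The formula for \<open>q\<close> holds at nonnegative arguments only, so the
      smaller argument of each pair must be nonnegative.\<close>
    have main: "alt_sum g k i = 4 * (A k - (-1) ^ i * A (k + int i)) + alt_sum (theta_diff w n) k i"
      if valid: "\<And>j. \<lbrakk>k \<le> j; j < k + int i\<rbrakk> \<Longrightarrow> 0 \<le> n - pent j - (2 * j + 1)" for i
    proof -
      have "alt_sum g k i = alt_sum (\<lambda>j. 4 * (A j + A (j + 1)) + theta_diff w n j) k i"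
      proof (rule alt_sum_cong)
        fix j assume j: "k \<le> j" "j < k + int i"
        have "g j = theta_diff (\<lambda>m. (2 * m + s)\<^sup>2) n j + theta_diff w n j"
          using valid[OF j] j k by (simp add: g_def theta_diff_def q)
        then show "g j = 4 * (A j + A (j + 1)) + theta_diff w n j"
          unfolding theta_diff_square A_def N_def .
      qed
      then show ?thesis
        by (simp only: alt_sum_add[of "\<lambda>j. 4 * (A j + A (j + 1))"] alt_sum_cmult alt_sum_telescope)
    qed
    \<comment> \<open>The exponents interlace:
      \<open>pent j + (2 * j + 1) \<le> pent (j + 1)\<close>.\<close>
    have valid: "0 \<le> n - pent j - (2 * j + 1)" if "k \<le> j" "j < K" for j
    proof -
      have "pent (j + 1) \<le> pent K" using that k by (intro pent_mono) auto
      then show ?thesis using K that k by (simp add: pent_add1)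
    qed
    have sum_l: "alt_sum g k l = 4 * (A k - (-1) ^ l * A K) + alt_sum (theta_diff w n) k l"
      using main[of l] valid l by simp
    have "K0\<^sup>2 \<le> K\<^sup>2" using K0 K0K by (intro power_mono) auto
    then have big: "R0 + R1 \<le> 4 * (K\<^sup>2 + K - 2)"
      using R K0K unfolding right_diff_distrib distrib_left by linarith
    have R0: "0 \<le> R0" using w[of 0] by linarith
    show ?thesis
    proof (cases "m < 2 * K + 1")
      \<comment> \<open>The pair at \<open>K\<close> is cut: only \<open>q m\<close> survives. The
        telescoping stops at \<open>A K\<close>, and one square and one value of \<open>w\<close>
        are left over.\<close>
      case True
      then have "g K = (2 * m + s)\<^sup>2 + w m"
        unfolding gK using m by (simp add: q q_neg)
      then have sum: "alt_sum g k L = 4 * (A k - (-1) ^ l * A K) + (-1) ^ l * (2 * m + s)\<^sup>2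
          + (alt_sum (theta_diff w n) k l + (-1) ^ l * w m)"
        unfolding sum_split sum_l by (simp add: algebra_simps)
      have "\<bar>(-1) ^ l * w m\<bar> \<le> R0" using w[of m] by (simp add: abs_mult)
      then have err: "alt_sum (theta_diff w n) k l + (-1) ^ l * w m \<ge> - (R0 + R1)"
        using alt_sum_w[of l] by linarith
      have "4 * (K\<^sup>2 + K - 2) \<le> 4 * (A k - (-1) ^ l * A K) + (-1) ^ l * (2 * m + s)\<^sup>2"
      proof (cases "even l")
        case True
        have "A k - A K = - (K - k) * N + 3 * K ^ 3 - 2 * K - 3 * k ^ 3 + 2 * k"
          by (simp add: A_def algebra_simps)
        then show ?thesis
          using True main_term_even_partial[of k K "2 * m + s"] k 3 by (simp flip: N)
      next
        case False
        have "A k + A K = (K + k) * N - 3 * K ^ 3 + 2 * K - 3 * k ^ 3 + 2 * k"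
          by (simp add: A_def algebra_simps)
        then show ?thesis
          using False main_term_odd_partial[of k K "2 * m + s"] k 3 K0 K0K s m \<open>m < 2 * K + 1\<close>
          by (simp flip: N)
      qed
      then show ?thesis using sum err big by (simp flip: g_def)
    next
      case False
      \<comment> \<open>The pair at \<open>K\<close> is complete, so the telescoping runs through
        \<open>K\<close> and ends at \<open>A (K + 1)\<close>.\<close>
      define M where "M = K + 1"
      have "0 \<le> n - pent j - (2 * j + 1)" if "k \<le> j" "j < M" for j
        using valid[of j] that False by (cases "j = K") (auto simp: M_def m_def)
      then have "alt_sum g k (Suc l) = 4 * (A k + (-1) ^ l * A M) + alt_sum (theta_diff w n) k (Suc l)"
        using main[of "Suc l"] l by (simp add: M_def add.assoc add.commute)
      moreover have "alt_sum g k L = alt_sum g k (Suc l)"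
        unfolding sum_split using alt_sum_append[of g k l 1] l by simp
      ultimately have sum: "alt_sum g k L = 4 * (A k + (-1) ^ l * A M) + alt_sum (theta_diff w n) k (Suc l)"
        by simp
      have KM: "K\<^sup>2 + K - 2 = M\<^sup>2 - M - 2"
        by (simp add: M_def power2_eq_square algebra_simps)
      have KM': "3 * K\<^sup>2 + K = 3 * M\<^sup>2 - 5 * M + 2"
        by (simp add: M_def power2_eq_square algebra_simps)
      have "K\<^sup>2 + K - 2 \<le> A k + (-1) ^ l * A M"
      proof (cases "even l")
        case True
        have "A k + A M = (M + k) * N - 3 * M ^ 3 + 2 * M - 3 * k ^ 3 + 2 * k"
          by (simp add: A_def algebra_simps)
        moreover have "N \<ge> 3 * M\<^sup>2 - M"
          using N KM' False s by (simp add: M_def)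
        ultimately show ?thesis
          using True main_term_even_full[of k M N] k 3 KM by (simp add: M_def)
      next
        case odd: False
        have "A k - A M = - (M - k) * N + 3 * M ^ 3 - 2 * M - 3 * k ^ 3 + 2 * k"
          by (simp add: A_def algebra_simps)
        moreover have "N \<le> 3 * M\<^sup>2 + M + 10"
          using N KM' m s by (simp add: M_def)
        ultimately show ?thesis
          using odd main_term_odd_full[of k M N] k 3 KM K0 K0K by (simp add: M_def)
      qed
      then have "R0 + R1 \<le> 4 * (A k + (-1) ^ l * A M)"
        using big by simp
      then show ?thesis using sum alt_sum_w[of "Suc l"] R0 by (simp add: g_def)
    qed
  qed
qed

section \<open>Small n by evaluation, and the eight triples\<close>

text \<open>For these \<open>n\<close> no index above \<open>K\<close> contributes, so the final
  segments of \<open>1, ..., K\<close> settle all \<open>k\<close> at once.\<close>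

definition small_ok :: "int list \<Rightarrow> int list \<Rightarrow> nat \<Rightarrow> bool" where
  "small_ok us vs K \<longleftrightarrow>
     list_all (\<lambda>n. list_all (\<lambda>x. 0 \<le> x) (alt_sums (theta_diff (trunc (qpoly us vs)) n) 1 K))
     [0..pent (int K + 1) - 1]"

lemma small_okD:
  assumes "small_ok us vs K" "0 \<le> n" "n < pent (int K + 1)" "1 \<le> k" "n < pent (k + int L)"
  shows "0 \<le> alt_sum (theta_diff (trunc (qpoly us vs)) n) k L"
proof -
  define g where "g = theta_diff (trunc (qpoly us vs)) n"
  have g_0: "g j = 0" if "n < pent i" "0 \<le> i" "i \<le> j" for i j
  proof -
    have "pent i \<le> pent j" using that by (intro pent_mono) auto
    then show ?thesis using that by (simp add: g_def theta_diff_def trunc_def)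
  qed
  show ?thesis
  proof (cases "k \<le> int K")
    case True
    define i where "i = nat (k - 1)"
    have i: "1 + int i = k" "i \<le> K" "k + int (K - i) = int K + 1"
      using True assms(4) by (auto simp: i_def)
    have "alt_sum g k (K - i) \<in> set (alt_sums g 1 K)"
      using alt_sum_in_alt_sums[OF i(2), of g 1] i(1) by simp
    then have "0 \<le> alt_sum g k (K - i)"
      using assms(1-3) unfolding small_ok_def list_all_iff g_def by simp
    \<comment> \<open>Both lengths reach past the last nonzero term, so the longer sum truncates to
      the shorter.\<close>
    also have "alt_sum g k (K - i) = alt_sum g k L"
    proof (cases "L \<le> K - i")
      case True
      then show ?thesis
        using assms by (intro alt_sum_truncate g_0[of "k + int L"]) auto
    next
      case False
      then have "alt_sum g k L = alt_sum g k (K - i)"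
        using assms i(3) by (intro alt_sum_truncate g_0[of "int K + 1"]) auto
      then show ?thesis by simp
    qed
    finally show ?thesis by (simp add: g_def)
  next
    case False
    then have "alt_sum g k L = 0"
      using assms by (intro alt_sum_eq_0 g_0[of "int K + 1"]) auto
    then show ?thesis by (simp add: g_def)
  qed
qed

text \<open>\<open>S\<close> and \<open>S'\<close> bound single periodic values, left over from a
  cut pair. \<open>R\<close> and \<open>R'\<close> bound sums up to the end of a period and are
  doubled because an arbitrary sum is, up to sign, a difference or sum of two of them. The length
  bound gives \<open>s \<le> 12\<close>, and \<open>7 \<le> K\<close> gives the threshold 8 for
  \<open>K + 1\<close>.\<close>

lemma gamma_nonneg:
  assumes init: "init_ok us vs"
    and per: "per_ok us R" "per_ok vs R'"
    and bound: "list_all (\<lambda>x. \<bar>x\<bar> \<le> S) us" "list_all (\<lambda>x. \<bar>x\<bar> \<le> S') vs"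
    and small: "small_ok us vs K"
    and K: "S + S' + 2 * (R + R') \<le> 4 * ((int K + 1)\<^sup>2 + (int K + 1) - 2)" "7 \<le> K"
    and len: "length us + length vs \<le> 11"
    and k: "1 \<le> k"
  shows "0 \<le> gamma 1 (length us) (length vs) (3/2) (1/2) k n"
proof -
  define q where "q = trunc (qpoly us vs)"
  have ne: "us \<noteq> []" "vs \<noteq> []" using init by (auto simp: init_ok_def)
  have L: "int n < pent (k + int (Suc n))"
    using pent_ge[of "k + int (Suc n)"] k by linarith
  have "0 \<le> alt_sum (theta_diff q (int n)) k (Suc n)"
  proof (cases "int n < pent (int K + 1)")
    case True
    then show ?thesis
      unfolding q_def by (intro small_okD[OF small]) (use k L in auto)
  next
    case False
    define w where "w = (\<lambda>m. cyc us m + cyc vs m)"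
    show ?thesis
    proof (rule alt_sum_theta_diff_nonneg[where ?K0.0 = "int K + 1" and ?R0.0 = "S + S'"
          and ?R1.0 = "2 * (R + R')" and w = w and s = "1 + int (length us) + int (length vs)"])
      show "q m = (2 * m + (1 + int (length us) + int (length vs)))\<^sup>2 + w m" if "0 \<le> m" for m
        using that by (simp add: q_def trunc_def qpoly_def w_def)
      show "q m = 0" if "m < 0" for m using that by (simp add: q_def trunc_def)
      show "q i \<le> q m" if "i \<le> m" for i m
        unfolding q_def using trunc_qpoly_mono[OF init that] .
      show "\<bar>w m\<bar> \<le> S + S'" for m
        using abs_cyc_le[OF ne(1) bound(1), of m] abs_cyc_le[OF ne(2) bound(2), of m]
        by (simp add: w_def)
      show "\<bar>alt_sum (theta_diff w (int n)) k l\<bar> \<le> 2 * (R + R')" for l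
      proof -
        have "theta_diff w (int n) = (\<lambda>j. theta_diff (cyc us) (int n) j + theta_diff (cyc vs) (int n) j)"
          by (simp add: theta_diff_def w_def fun_eq_iff)
        then have "alt_sum (theta_diff w (int n)) k l =
            alt_sum (theta_diff (cyc us) (int n)) k l + alt_sum (theta_diff (cyc vs) (int n)) k l"
          by (simp add: alt_sum_add)
        then show ?thesis
          using per_okD[OF per(1) ne(1), of "int n" k l] per_okD[OF per(2) ne(2), of "int n" k l]
          unfolding distrib_left by linarith
      qed
    qed (use K len k L False in auto)
  qed
  moreover have "(0 :: rat) < 8 * of_nat (length us) * of_nat (length vs)"
    using ne by simp
  ultimately show ?thesis
    using gamma_eq_alt_sum[OF init k, of n] unfolding q_def
    by (metis of_int_0_le_iff zero_le_mult_iff order.strict_implies_not_eq order.asym le_less)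
qed

text \<open>In each case the lists are the periodic parts of \<open>8 b c\<close> times the number of partitions into
  parts \<open>1, b, c\<close>, determined up to moving a constant between them.  \<open>K + 1\<close> is an index
  from which on the main term exceeds the periodic error.\<close>

lemma gamma_1_2_3_nonneg:
  assumes "1 \<le> k"
  shows "0 \<le> gamma 1 2 3 (3/2) (1/2) k n"
proof -
  have "0 \<le> gamma 1 (length ([6, -6] :: int list)) (length ([6, -10, -10] :: int list)) (3/2) (1/2) k n"
    by (rule gamma_nonneg[where R = 12 and R' = 16 and S = 6 and S' = 10 and K = 7])
      (code_simp | fact assms)+
  then show ?thesis by (simp add: eval_nat_numeral)
qed

lemma gamma_1_2_5_nonneg:
  assumes "1 \<le> k"
  shows "0 \<le> gamma 1 2 5 (3/2) (1/2) k n"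
proof -
  have "0 \<le> gamma 1 (length ([10, -10] :: int list)) (length ([6, -10, 6, -26, -26] :: int list)) (3/2) (1/2) k n"
    by (rule gamma_nonneg[where R = 20 and R' = 64 and S = 10 and S' = 26 and K = 7])
      (code_simp | fact assms)+
  then show ?thesis by (simp add: eval_nat_numeral)
qed

lemma gamma_1_2_7_nonneg:
  assumes "1 \<le> k"
  shows "0 \<le> gamma 1 2 7 (3/2) (1/2) k n"
proof -
  have "0 \<le> gamma 1 (length ([14, -14] :: int list)) (length ([-2, -18, 14, -18, -2, -50, -50] :: int list)) (3/2) (1/2) k n"
    by (rule gamma_nonneg[where R = 28 and R' = 112 and S = 14 and S' = 50 and K = 8])
      (code_simp | fact assms)+
  then show ?thesis by (simp add: eval_nat_numeral)
qed

lemma gamma_1_3_4_nonneg: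
  assumes "1 \<le> k"
  shows "0 \<le> gamma 1 3 4 (3/2) (1/2) k n"
proof -
  have "0 \<le> gamma 1 (length ([11, 11, -21] :: int list)) (length ([21, -15, -27, -15] :: int list)) (3/2) (1/2) k n"
    by (rule gamma_nonneg[where R = 32 and R' = 48 and S = 21 and S' = 27 and K = 7])
      (code_simp | fact assms)+
  then show ?thesis by (simp add: eval_nat_numeral)
qed

lemma gamma_1_3_5_nonneg:
  assumes "1 \<le> k"
  shows "0 \<le> gamma 1 3 5 (3/2) (1/2) k n"
proof -
  have "0 \<le> gamma 1 (length ([27, -13, -13] :: int list)) (length ([12, 12, -36, -12, -36] :: int list)) (3/2) (1/2) k n"
    by (rule gamma_nonneg[where R = 40 and R' = 96 and S = 27 and S' = 36 and K = 8])
      (code_simp | fact assms)+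
  then show ?thesis by (simp add: eval_nat_numeral)
qed

lemma gamma_1_3_8_nonneg:
  assumes "1 \<le> k"
  shows "0 \<le> gamma 1 3 8 (3/2) (1/2) k n"
proof -
  have "0 \<le> gamma 1 (length ([43, -21, -21] :: int list)) (length ([5, 17, -43, 17, 5, -79, -43, -79] :: int list)) (3/2) (1/2) k n"
    by (rule gamma_nonneg[where R = 64 and R' = 192 and S = 43 and S' = 79 and K = 12])
      (code_simp | fact assms)+
  then show ?thesis by (simp add: eval_nat_numeral)
qed

lemma gamma_1_4_5_nonneg:
  assumes "1 \<le> k"
  shows "0 \<le> gamma 1 4 5 (3/2) (1/2) k n"
proof -
  have "0 \<le> gamma 1 (length ([10, 30, 10, -50] :: int list)) (length ([50, -14, -46, -46, -14] :: int list)) (3/2) (1/2) k n"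
    by (rule gamma_nonneg[where R = 80 and R' = 160 and S = 50 and S' = 50 and K = 11])
      (code_simp | fact assms)+
  then show ?thesis by (simp add: eval_nat_numeral)
qed

lemma gamma_1_4_7_nonneg:
  assumes "1 \<le> k"
  shows "0 \<le> gamma 1 4 7 (3/2) (1/2) k n"
proof -
  have "0 \<le> gamma 1 (length ([70, -14, -42, -14] :: int list)) (length ([10, 42, 10, -86, -22, -22, -86] :: int list)) (3/2) (1/2) k n"
    by (rule gamma_nonneg[where R = 112 and R' = 224 and S = 70 and S' = 86 and K = 13])
      (code_simp | fact assms)+
  then show ?thesis by (simp add: eval_nat_numeral)
qed

theorem corollary2p3:
  fixes k :: int and n a b c :: nat
  assumes "k \<ge> 1"
    and "(a, b, c) \<in> {(1,2,3), (1,2,5), (1,2,7), (1,3,4), (1,3,5), (1,3,8), (1,4,5), (1,4,7)}"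
  shows "gamma a b c (3/2) (1/2) k n \<ge> 0"
  using assms
    gamma_1_2_3_nonneg gamma_1_2_5_nonneg gamma_1_2_7_nonneg
    gamma_1_3_4_nonneg gamma_1_3_5_nonneg gamma_1_3_8_nonneg
    gamma_1_4_5_nonneg gamma_1_4_7_nonneg
  by auto

end
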